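(* Let $d\ge 1$, let $\{|n\rangle\mid n=0,\dots,d-1\}$ be an orthonormal basis of a $d$-dimensional Hilbert space $\mathcal{H}$, and let $|e_n\rangle=\frac{1}{\sqrt d}\sum_{m=0}^{d-1}\omega^{mn}|m\rangle$ with $\omega=\exp(2\pi i/d)$, $n=0,\dots,d-1$. Let $p\in[0,1]$. A system is prepared at random, in the state $\rho_{1n}=|n\rangle\langle n|$ with probability $p/d$ and in the state $\rho_{2n}=|e_n\rangle\langle e_n|$ with probability $(1-p)/d$, for $n=0,\dots,d-1$. Then, among all POVMs $\{P(i,n)\mid i\in\{1,2\},\ n\in\{0,\dots,d-1\}\}$ on $\mathcal{H}$, the minimum error probability in determining the label $(i,n)$ of the prepared state is achieved by $P^{(1)}(i,n)=\delta_{i1}|n\rangle\langle n|$ if $p\ge 1/2$, and by $P^{(2)}(i,n)=\delta_{i2}|e_n\rangle\langle e_n|$ otherwise.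
   Context: A POVM with outcomes $(i,n)$ is a family of positive semidefinite operators $P(i,n)$ on $\mathcal{H}$ with $\sum_{i,n}P(i,n)=1_{\mathcal H}$. When the state is $\rho$, outcome $(i,n)$ occurs with probability $\mathrm{Tr}[\rho P(i,n)]$ and the guess is then $\rho_{in}$. The error probability is $$1-\sum_{n=0}^{d-1}\Big(\tfrac{p}{d}\,\mathrm{Tr}[\rho_{1n}P(1,n)]+\tfrac{1-p}{d}\,\mathrm{Tr}[\rho_{2n}P(2,n)]\Big).$$ *)

theory Defs
  imports "HOL-Analysis.Analysis" "HOL-Library.Complex_Order"
begin

text \<open>Complex inner product spaces, with the physicists' convention: \<open>cinner\<close> is antilinear in
  its first argument. In finite dimension such a space is complete, that is, a Hilbert space.
  The order on complex numbers is that of \<open>HOL-Library.Complex_Order\<close>: \<open>0 \<le> z\<close> says that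
  \<open>z\<close> is real and nonnegative.\<close>

class complex_inner = ab_group_add +
  fixes scaleC :: "complex \<Rightarrow> 'a \<Rightarrow> 'a"  (infixr \<open>*\<^sub>C\<close> 75)
    and cinner :: "'a \<Rightarrow> 'a \<Rightarrow> complex"
  assumes scaleC_add_right: "a *\<^sub>C (x + y) = a *\<^sub>C x + a *\<^sub>C y"
    and scaleC_add_left: "(a + b) *\<^sub>C x = a *\<^sub>C x + b *\<^sub>C x"
    and scaleC_scaleC: "a *\<^sub>C b *\<^sub>C x = (a * b) *\<^sub>C x"
    and scaleC_one: "1 *\<^sub>C x = x"
    and cinner_commute: "cinner x y = cnj (cinner y x)"
    and cinner_add_right: "cinner x (y + z) = cinner x y + cinner x z"
    and cinner_scaleC_right: "cinner x (a *\<^sub>C y) = a * cinner x y"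
    and cinner_gt_zero: "x \<noteq> 0 \<Longrightarrow> 0 < cinner x x"

global_interpretation cvec: vector_space "scaleC :: complex \<Rightarrow> 'a \<Rightarrow> 'a::complex_inner"
  by unfold_locales (simp_all add: scaleC_add_right scaleC_add_left scaleC_scaleC scaleC_one)

abbreviation clinear :: "('a::complex_inner \<Rightarrow> 'a) \<Rightarrow> bool"
  where "clinear \<equiv> Vector_Spaces.linear scaleC scaleC"

definition orthonormal_basis :: "nat \<Rightarrow> (nat \<Rightarrow> 'a::complex_inner) \<Rightarrow> bool"
  where "orthonormal_basis d b \<longleftrightarrow>
    (\<forall>m<d. \<forall>n<d. cinner (b m) (b n) = (if m = n then 1 else 0)) \<and>
    cvec.span (b ` {..<d}) = UNIV"

text \<open>The trace of an operator is the sum of the diagonal entries of its matrix in some basis,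
  here the one that the library chooses; any finite basis gives the same value
  (\<open>ctrace_eq_sum_basis\<close>).\<close>

definition ctrace :: "('a::complex_inner \<Rightarrow> 'a) \<Rightarrow> complex"
  where "ctrace A = (let B = cvec.extend_basis {} in \<Sum>v\<in>B. cvec.representation B (A v) v)"

lemma sum_diagonal_basis_independent:
  fixes A :: "'a::complex_inner \<Rightarrow> 'a"
  assumes A: "clinear A"
    and B: "finite B" "cvec.independent B" "cvec.span B = UNIV"
    and C: "finite C" "cvec.independent C" "cvec.span C = UNIV"
  shows "(\<Sum>v\<in>B. cvec.representation B (A v) v) = (\<Sum>w\<in>C. cvec.representation C (A w) w)"
proof -
  interpret A: Vector_Spaces.linear scaleC scaleC A by (rule A)
  let ?rB = "cvec.representation B" and ?rC = "cvec.representation C"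
  have expB: "x = (\<Sum>v\<in>B. ?rB x v *\<^sub>C v)" for x
    using cvec.sum_representation_eq[OF B(2) _ B(1) order_refl, of x] B(3) by simp
  have expC: "x = (\<Sum>w\<in>C. ?rC x w *\<^sub>C w)" for x
    using cvec.sum_representation_eq[OF C(2) _ C(1) order_refl, of x] C(3) by simp
  have repB: "?rB (\<Sum>w\<in>S. f w *\<^sub>C g w) v = (\<Sum>w\<in>S. f w * ?rB (g w) v)"
    for S :: "'a set" and f g v
    using B by (simp add: cvec.representation_sum cvec.representation_scale)
  have repC: "?rC (\<Sum>w\<in>S. f w *\<^sub>C g w) v = (\<Sum>w\<in>S. f w * ?rC (g w) v)"
    for S :: "'a set" and f g v
    using C by (simp add: cvec.representation_sum cvec.representation_scale)
  have "(\<Sum>v\<in>B. ?rB (A v) v) = (\<Sum>v\<in>B. \<Sum>w\<in>C. ?rC (A v) w * ?rB w v)"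
  proof (intro sum.cong refl)
    fix v assume "v \<in> B"
    show "?rB (A v) v = (\<Sum>w\<in>C. ?rC (A v) w * ?rB w v)"
      by (subst expC[of "A v"]) (simp only: repB)
  qed
  also have "\<dots> = (\<Sum>w\<in>C. \<Sum>v\<in>B. ?rB w v * ?rC (A v) w)"
    by (subst sum.swap) (simp add: mult.commute)
  also have "\<dots> = (\<Sum>w\<in>C. ?rC (A w) w)"
  proof (intro sum.cong refl)
    fix w assume "w \<in> C"
    have "A w = (\<Sum>v\<in>B. ?rB w v *\<^sub>C A v)"
      by (subst expB[of w]) (simp only: A.sum A.scale)
    then show "(\<Sum>v\<in>B. ?rB w v * ?rC (A v) w) = ?rC (A w) w"
      by (simp only: repC)
  qed
  finally show ?thesis .
qed

lemma ctrace_eq_sum_basis: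
  fixes A :: "'a::complex_inner \<Rightarrow> 'a"
  assumes A: "clinear A"
    and B: "finite B" "cvec.independent B" "cvec.span B = UNIV"
  shows "ctrace A = (\<Sum>v\<in>B. cvec.representation B (A v) v)"
proof -
  let ?C = "cvec.extend_basis {} :: 'a set"
  have C: "cvec.independent ?C" "cvec.span ?C = UNIV"
    by (simp_all add: cvec.independent_extend_basis cvec.span_extend_basis cvec.independent_empty)
  moreover have "finite ?C"
    using cvec.independent_span_bound[OF B(1) C(1)] B(3) by simp
  ultimately show ?thesis
    unfolding ctrace_def Let_def by (intro sum_diagonal_basis_independent A B)
qed

text \<open>\<open>|v\<rangle>\<langle>v|\<close>\<close>

definition ketbra :: "'a::complex_inner \<Rightarrow> 'a \<Rightarrow> 'a"
  where "ketbra v = (\<lambda>x. cinner v x *\<^sub>C v)"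

definition fourier_vec :: "nat \<Rightarrow> (nat \<Rightarrow> 'a::complex_inner) \<Rightarrow> nat \<Rightarrow> 'a"
  where "fourier_vec d b n =
    (let \<omega> = exp (2 * of_real pi * \<i> / of_nat d)
     in (1 / of_real (sqrt (real d))) *\<^sub>C (\<Sum>m<d. \<omega> ^ (m * n) *\<^sub>C b m))"

text \<open>On a complex space, \<open>0 \<le> cinner x (A x)\<close> for all \<open>x\<close> already makes \<open>A\<close> self-adjoint.\<close>

definition positive_semidefinite :: "('a::complex_inner \<Rightarrow> 'a) \<Rightarrow> bool"
  where "positive_semidefinite A \<longleftrightarrow> clinear A \<and> (\<forall>x. 0 \<le> cinner x (A x))"

definition povm :: "nat \<Rightarrow> (nat \<Rightarrow> nat \<Rightarrow> 'a::complex_inner \<Rightarrow> 'a) \<Rightarrow> bool"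
  where "povm d P \<longleftrightarrow>
    (\<forall>i\<in>{1,2}. \<forall>n<d. positive_semidefinite (P i n)) \<and>
    (\<forall>x. (\<Sum>i\<in>{1,2}. \<Sum>n<d. P i n x) = x)"

text \<open>The trace of a product of two positive semidefinite operators is real, so \<open>Re\<close> only
  changes the type.\<close>

definition outcome_prob :: "('a::complex_inner \<Rightarrow> 'a) \<Rightarrow> ('a \<Rightarrow> 'a) \<Rightarrow> real"
  where "outcome_prob \<rho> E = Re (ctrace (\<rho> \<circ> E))"

definition error_prob ::
  "nat \<Rightarrow> real \<Rightarrow> (nat \<Rightarrow> nat \<Rightarrow> 'a::complex_inner \<Rightarrow> 'a) \<Rightarrow> (nat \<Rightarrow> nat \<Rightarrow> 'a \<Rightarrow> 'a) \<Rightarrow> real"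
  where "error_prob d p \<rho> P =
    1 - (\<Sum>n<d. p / real d * outcome_prob (\<rho> 1 n) (P 1 n)
             + (1 - p) / real d * outcome_prob (\<rho> 2 n) (P 2 n))"

definition attains_min_error ::
  "nat \<Rightarrow> real \<Rightarrow> (nat \<Rightarrow> nat \<Rightarrow> 'a::complex_inner \<Rightarrow> 'a) \<Rightarrow> (nat \<Rightarrow> nat \<Rightarrow> 'a \<Rightarrow> 'a) \<Rightarrow> bool"
  where "attains_min_error d p \<rho> P \<longleftrightarrow>
    povm d P \<and> (\<forall>Q. povm d Q \<longrightarrow> error_prob d p \<rho> P \<le> error_prob d p \<rho> Q)"

text \<open>Only the labels \<open>i = 1\<close> and \<open>i = 2\<close> are ever used.\<close>

definition prepared_state ::
  "nat \<Rightarrow> (nat \<Rightarrow> 'a::complex_inner) \<Rightarrow> nat \<Rightarrow> nat \<Rightarrow> 'a \<Rightarrow> 'a"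
  where "prepared_state d b i n = (if i = 1 then ketbra (b n) else ketbra (fourier_vec d b n))"

end

(* The success probability of a POVM is at most max(p, 1 - p)/d times the sum of
   <v, P(i,n) v> over the prepared unit vectors v. Completing each such v to an orthonormal basis
   shows <v, P(i,n) v> <= Tr P(i,n), and the traces add up to Tr 1 = d. Hence the success
   probability never exceeds max(p, 1 - p), and measuring in the likelier of the two bases
   attains this value. Of the Fourier vectors only their orthonormality matters. *)
theory Submission
  imports Defs
begin

section \<open>Inner products and orthonormal families\<close>

lemma cinner_scaleC_left: "cinner (a *\<^sub>C x) (y::'a::complex_inner) = cnj a * cinner x y"
  by (subst (1 2) cinner_commute) (simp add: cinner_scaleC_right)

lemma cinner_zero_right [simp]: "cinner (x::'a::complex_inner) 0 = 0"
  using cinner_add_right[of x 0 0] by simp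

lemma cinner_sum_right:
  "cinner (x::'a::complex_inner) (\<Sum>i\<in>I. f i) = (\<Sum>i\<in>I. cinner x (f i))"
  by (induction I rule: infinite_finite_induct) (simp_all add: cinner_add_right)

lemma cinner_sum_left:
  "cinner (\<Sum>i\<in>I. f i) (x::'a::complex_inner) = (\<Sum>i\<in>I. cinner (f i) x)"
proof -
  have "cinner (\<Sum>i\<in>I. f i) x = cnj (cinner x (\<Sum>i\<in>I. f i))"
    by (rule cinner_commute)
  also have "\<dots> = (\<Sum>i\<in>I. cnj (cinner x (f i)))"
    by (simp add: cinner_sum_right)
  also have "\<dots> = (\<Sum>i\<in>I. cinner (f i) x)"
    by (rule sum.cong[OF refl], rule cinner_commute[symmetric])
  finally show ?thesis .
qed

lemma cinner_sum_orthonormal: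
  fixes b :: "nat \<Rightarrow> 'a::complex_inner"
  assumes "\<forall>m<d. \<forall>n<d. cinner (b m) (b n) = (if m = n then 1 else 0)" "m < d"
  shows "cinner (b m) (\<Sum>n<d. f n *\<^sub>C b n) = f m"
proof -
  have "cinner (b m) (\<Sum>n<d. f n *\<^sub>C b n) = (\<Sum>n<d. f n * cinner (b m) (b n))"
    by (simp add: cinner_sum_right cinner_scaleC_right)
  also have "\<dots> = (\<Sum>n<d. if n = m then f n else 0)"
    using assms by (intro sum.cong) auto
  also have "\<dots> = f m"
    using assms(2) by simp
  finally show ?thesis .
qed

lemma inj_on_orthonormal:
  fixes b :: "nat \<Rightarrow> 'a::complex_inner"
  assumes "\<forall>m<d. \<forall>n<d. cinner (b m) (b n) = (if m = n then 1 else 0)"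
  shows "inj_on b {..<d}"
proof (rule inj_onI)
  fix m n assume mn: "m \<in> {..<d}" "n \<in> {..<d}" "b m = b n"
  then have "cinner (b m) (b n) = 1"
    using assms by auto
  then show "m = n"
    using assms mn(1,2) by (auto split: if_splits)
qed

text \<open>Pairing a vanishing linear combination with \<open>b m\<close> isolates its m-th
  coefficient.\<close>

lemma independent_orthonormal:
  fixes b :: "nat \<Rightarrow> 'a::complex_inner"
  assumes on: "\<forall>m<d. \<forall>n<d. cinner (b m) (b n) = (if m = n then 1 else 0)"
  shows "cvec.independent (b ` {..<d})"
proof (rule cvec.independent_if_scalars_zero)
  fix f x assume 0: "(\<Sum>x\<in>b ` {..<d}. f x *\<^sub>C x) = 0" and "x \<in> b ` {..<d}"
  then obtain m where m: "m < d" "x = b m" by auto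
  have "(\<Sum>n<d. f (b n) *\<^sub>C b n) = 0"
    using 0 by (simp add: sum.reindex[OF inj_on_orthonormal[OF on]])
  then show "f x = 0"
    using cinner_sum_orthonormal[OF on m(1), of "\<lambda>n. f (b n)"] m(2) by simp
qed simp

text \<open>Pairing the abstract expansion of \<open>x\<close> with \<open>b m\<close> leaves only
  its m-th coefficient, so coordinates become inner products.\<close>

lemma
  fixes b :: "nat \<Rightarrow> 'a::complex_inner"
  assumes b: "orthonormal_basis d b"
  shows orthonormal_basis_expansion: "(\<Sum>n<d. cinner (b n) x *\<^sub>C b n) = x"
    and representation_orthonormal_basis:
      "m < d \<Longrightarrow> cvec.representation (b ` {..<d}) x (b m) = cinner (b m) x"
proof -
  let ?r = "cvec.representation (b ` {..<d})"
  have on: "\<forall>m<d. \<forall>n<d. cinner (b m) (b n) = (if m = n then 1 else 0)"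
    and sp: "cvec.span (b ` {..<d}) = UNIV"
    using b unfolding orthonormal_basis_def by blast+
  have x: "(\<Sum>n<d. ?r x (b n) *\<^sub>C b n) = x"
    using cvec.sum_representation_eq[OF independent_orthonormal[OF on] _ _ order_refl, of x] sp
    by (simp add: sum.reindex[OF inj_on_orthonormal[OF on]])
  show r: "?r x (b m) = cinner (b m) x" if "m < d" for m
    using cinner_sum_orthonormal[OF on that, of "\<lambda>n. ?r x (b n)"] x by simp
  show "(\<Sum>n<d. cinner (b n) x *\<^sub>C b n) = x"
    using x r by simp
qed

text \<open>Frees the trace from the basis in its definition: below it is evaluated in whichever
  orthonormal basis contains the vectors at hand.\<close>

lemma ctrace_orthonormal_basis:
  fixes b :: "nat \<Rightarrow> 'a::complex_inner"
  assumes b: "orthonormal_basis d b" and A: "clinear A"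
  shows "ctrace A = (\<Sum>n<d. cinner (b n) (A (b n)))"
proof -
  have on: "\<forall>m<d. \<forall>n<d. cinner (b m) (b n) = (if m = n then 1 else 0)"
    and sp: "cvec.span (b ` {..<d}) = UNIV"
    using b unfolding orthonormal_basis_def by blast+
  show ?thesis
    using ctrace_eq_sum_basis[OF A _ independent_orthonormal[OF on] sp]
    by (simp add: sum.reindex[OF inj_on_orthonormal[OF on]]
        representation_orthonormal_basis[OF b])
qed

text \<open>Dimension count: a vector outside the span of \<open>c\<close> would extend its d
  independent members to d + 1 independent vectors in a space spanned by d. For the Fourier vectors
  this replaces an explicit inversion formula.\<close>

lemma orthonormal_basis_transfer:
  fixes b c :: "nat \<Rightarrow> 'a::complex_inner"
  assumes b: "orthonormal_basis d b"
    and on: "\<forall>m<d. \<forall>n<d. cinner (c m) (c n) = (if m = n then 1 else 0)"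
  shows "orthonormal_basis d c"
proof -
  have "x \<in> cvec.span (c ` {..<d})" for x
  proof (rule ccontr)
    assume x: "x \<notin> cvec.span (c ` {..<d})"
    then have "cvec.independent (insert x (c ` {..<d}))"
      by (intro cvec.independent_insertI independent_orthonormal on)
    then have "card (insert x (c ` {..<d})) \<le> card (b ` {..<d})"
      using cvec.independent_span_bound[of "b ` {..<d}" "insert x (c ` {..<d})"] b
      by (simp add: orthonormal_basis_def)
    also have "\<dots> \<le> d"
      using card_image_le[of "{..<d}" b] by simp
    moreover have "x \<notin> c ` {..<d}"
      using x cvec.span_base[of x "c ` {..<d}"] by blast
    ultimately show False
      by (simp add: card_image inj_on_orthonormal[OF on])
  qed
  then have "cvec.span (c ` {..<d}) = UNIV"
    by (rule UNIV_eq_I[symmetric])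
  with on show ?thesis
    unfolding orthonormal_basis_def by (rule conjI)
qed

section \<open>Orthonormality of the Fourier vectors\<close>

lemma sum_root_of_unity_characters:
  fixes d m n :: nat
  defines "\<omega> \<equiv> exp (2 * of_real pi * \<i> / of_nat d) :: complex"
  assumes "m < d" "n < d"
  shows "(\<Sum>k<d. cnj (\<omega> ^ (k * m)) * \<omega> ^ (k * n)) = (if m = n then of_nat d else 0)"
proof -
  \<comment> \<open>The character sum is the geometric series with ratio \<open>z\<close>. This
    ratio is \<open>\<omega>\<close> to the power n - m, written with a conjugate in place of the
    inverse to avoid truncated subtraction.\<close>
  define z where "z = cnj (\<omega> ^ m) * \<omega> ^ n"
  have pow: "\<omega> ^ j = exp (2 * of_real pi * \<i> * of_nat j / of_nat d)" for j
    unfolding \<omega>_def exp_of_nat_mult[symmetric] by (simp add: field_simps)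
  have cnj: "cnj (\<omega> ^ j) * \<omega> ^ j = 1" for j
    by (simp add: pow exp_cnj flip: exp_add)
  have d: "\<omega> ^ d = 1"
    using assms(2) unfolding pow by simp
  have "(\<Sum>k<d. cnj (\<omega> ^ (k * m)) * \<omega> ^ (k * n)) = (\<Sum>k<d. z ^ k)"
    by (simp add: z_def power_mult_distrib mult.commute flip: power_mult)
  also have "\<dots> = (if m = n then of_nat d else 0)"
  proof (cases "m = n")
    case True
    then show ?thesis using cnj[of n] by (simp add: z_def)
  next
    case False
    \<comment> \<open>Multiplying \<open>z = 1\<close> by \<open>\<omega> ^ m\<close> cancels the
      conjugate and equates two powers of a primitive d-th root of unity whose exponents are
      distinct and below d.\<close>
    have "z \<noteq> 1"
    proof
      assume "z = 1"
      then have "\<omega> ^ m * (cnj (\<omega> ^ m) * \<omega> ^ n) = \<omega> ^ m"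
        by (simp add: z_def)
      also have "\<omega> ^ m * (cnj (\<omega> ^ m) * \<omega> ^ n) = (cnj (\<omega> ^ m) * \<omega> ^ m) * \<omega> ^ n"
        by (simp only: ac_simps)
      finally have "\<omega> ^ n = \<omega> ^ m"
        by (simp only: cnj mult_1)
      moreover have "\<omega> ^ j = exp (2 * of_real pi * \<i> * (of_nat j / of_nat d))" for j
        by (simp add: pow)
      ultimately show False
        using complex_root_unity_eq[of d n m] assms(2,3) False by simp
    qed
    \<comment> \<open>This makes the numerator of the geometric sum vanish.\<close>
    moreover have "z ^ d = 1"
    proof -
      have "z ^ d = cnj ((\<omega> ^ d) ^ m) * (\<omega> ^ d) ^ n"
        by (simp add: z_def power_mult_distrib mult.commute flip: power_mult)
      then show ?thesis
        by (simp add: d)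
    qed
    ultimately show ?thesis
      using False by (simp add: geometric_sum)
  qed
  finally show ?thesis .
qed

lemma orthonormal_basis_fourier_vec:
  fixes b :: "nat \<Rightarrow> 'a::complex_inner"
  assumes b: "orthonormal_basis d b"
  shows "orthonormal_basis d (fourier_vec d b)"
proof (rule orthonormal_basis_transfer[OF b], intro allI impI)
  fix m n assume mn: "m < d" "n < d"
  let ?s = "1 / of_real (sqrt (real d)) :: complex"
  define \<omega> where "\<omega> = exp (2 * of_real pi * \<i> / of_nat d :: complex)"
  have on: "\<forall>m<d. \<forall>n<d. cinner (b m) (b n) = (if m = n then 1 else 0)"
    using b by (simp add: orthonormal_basis_def)
  have f: "fourier_vec d b j = ?s *\<^sub>C (\<Sum>k<d. \<omega> ^ (k * j) *\<^sub>C b k)" for j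
    by (simp add: fourier_vec_def \<omega>_def Let_def)
  \<comment> \<open>Orthonormality of \<open>b\<close> collapses the double sum to the diagonal,
    leaving a character sum; the two normalizing factors then cancel its value d.\<close>
  have "cinner (fourier_vec d b m) (fourier_vec d b n)
      = cnj ?s * ?s * (\<Sum>k<d. cnj (\<omega> ^ (k * m)) * \<omega> ^ (k * n))"
    by (simp add: f cinner_scaleC_left cinner_scaleC_right cinner_sum_left
        cinner_sum_orthonormal[OF on])
  also have "cnj ?s * ?s = 1 / of_nat d"
    by (simp flip: of_real_mult)
  also have "(\<Sum>k<d. cnj (\<omega> ^ (k * m)) * \<omega> ^ (k * n)) = (if m = n then of_nat d else 0)"
    unfolding \<omega>_def by (rule sum_root_of_unity_characters[OF mn])
  finally show "cinner (fourier_vec d b m) (fourier_vec d b n) = (if m = n then 1 else 0)"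
    using mn by simp
qed

section \<open>Outcome probabilities and traces of POVM elements\<close>

lemma positive_semidefinite_ketbra: "positive_semidefinite (ketbra (v::'a::complex_inner))"
proof -
  have "clinear (ketbra v)"
    by unfold_locales
      (simp_all add: ketbra_def cinner_add_right cinner_scaleC_right scaleC_add_left scaleC_scaleC)
  moreover have "0 \<le> cinner x (ketbra v x)" for x
  proof -
    \<comment> \<open>The quadratic form is a squared modulus.\<close>
    have "cinner x (ketbra v x) = cinner v x * cnj (cinner v x)"
      by (simp add: ketbra_def cinner_scaleC_right flip: cinner_commute)
    also have "0 \<le> \<dots>"
      by (simp add: complex_mult_cnj less_eq_complex_def)
    finally show ?thesis .
  qed
  ultimately show ?thesis
    by (simp add: positive_semidefinite_def)
qed

lemma positive_semidefinite_zero: "positive_semidefinite (\<lambda>x::'a::complex_inner. 0)"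
proof -
  have "clinear (\<lambda>x::'a. 0)"
    by unfold_locales simp_all
  then show ?thesis
    by (simp add: positive_semidefinite_def)
qed

text \<open>The trace is taken in the basis \<open>c\<close> that contains the state vector, so
  orthogonality removes every diagonal term but the n-th.\<close>

lemma outcome_prob_ketbra:
  fixes c :: "nat \<Rightarrow> 'a::complex_inner"
  assumes c: "orthonormal_basis d c" and E: "clinear E" and n: "n < d"
  shows "outcome_prob (ketbra (c n)) E = Re (cinner (c n) (E (c n)))"
proof -
  have "clinear (ketbra (c n) \<circ> E)"
    using positive_semidefinite_ketbra[of "c n"] E
    by (auto simp: positive_semidefinite_def intro: Vector_Spaces.linear_compose)
  then have "ctrace (ketbra (c n) \<circ> E)
      = (\<Sum>m<d. cinner (c n) (E (c m)) * cinner (c m) (c n))"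
    by (simp add: ctrace_orthonormal_basis[OF c] ketbra_def cinner_scaleC_right)
  also have "\<dots> = (\<Sum>m<d. if m = n then cinner (c n) (E (c m)) else 0)"
    using c n by (intro sum.cong) (auto simp: orthonormal_basis_def)
  also have "\<dots> = cinner (c n) (E (c n))"
    using n by simp
  finally show ?thesis
    by (simp add: outcome_prob_def)
qed

text \<open>The left side is one diagonal entry of \<open>E\<close> in the basis \<open>c\<close>;
  the other entries of the trace are nonnegative.\<close>

lemma Re_cinner_le_ctrace:
  fixes c :: "nat \<Rightarrow> 'a::complex_inner"
  assumes c: "orthonormal_basis d c" and E: "positive_semidefinite E" and n: "n < d"
  shows "Re (cinner (c n) (E (c n))) \<le> Re (ctrace E)"
proof -
  have "Re (cinner (c n) (E (c n))) \<le> (\<Sum>m<d. Re (cinner (c m) (E (c m))))"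
    using E n by (intro member_le_sum) (auto simp: positive_semidefinite_def less_eq_complex_def)
  then show ?thesis
    using E by (simp add: ctrace_orthonormal_basis[OF c] positive_semidefinite_def)
qed

lemma sum_ctrace_povm:
  fixes b :: "nat \<Rightarrow> 'a::complex_inner" and P :: "nat \<Rightarrow> nat \<Rightarrow> 'a \<Rightarrow> 'a"
  assumes b: "orthonormal_basis d b" and P: "povm d P"
  shows "(\<Sum>n<d. ctrace (P 1 n) + ctrace (P 2 n)) = of_nat d"
proof -
  have "(\<Sum>n<d. ctrace (P 1 n) + ctrace (P 2 n))
      = (\<Sum>n<d. \<Sum>m<d. cinner (b m) (P 1 n (b m) + P 2 n (b m)))"
    using P by (intro sum.cong)
      (simp_all add: povm_def positive_semidefinite_def ctrace_orthonormal_basis[OF b]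
        cinner_add_right sum.distrib)
  \<comment> \<open>With the sum over outcomes innermost, completeness of the POVM applies to each
    \<open>b m\<close>.\<close>
  also have "\<dots> = (\<Sum>m<d. cinner (b m) (\<Sum>n<d. P 1 n (b m) + P 2 n (b m)))"
    by (subst sum.swap) (simp add: cinner_sum_right)
  also have "\<dots> = (\<Sum>m<d. cinner (b m) (b m))"
    using P by (simp add: povm_def sum.distrib)
  also have "\<dots> = of_nat d"
    using b by (simp add: orthonormal_basis_def)
  finally show ?thesis .
qed

section \<open>The error bound and its attainment\<close>

lemma error_prob_lower_bound:
  fixes b c :: "nat \<Rightarrow> 'a::complex_inner"
  assumes d: "d \<ge> 1" and b: "orthonormal_basis d b" and c: "orthonormal_basis d c"
    and p: "0 \<le> p" "p \<le> 1" and P: "povm d P"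
  shows "1 - max p (1 - p)
    \<le> error_prob d p (\<lambda>i n. if i = 1 then ketbra (b n) else ketbra (c n)) P"
proof -
  \<comment> \<open>The larger of the two prior probabilities of a single state. Using it for both
    values of i lets all traces be added with one common weight.\<close>
  let ?M = "max p (1 - p) / real d"
  have psd: "positive_semidefinite (P 1 n)" "positive_semidefinite (P 2 n)" if "n < d" for n
    using P that by (auto simp: povm_def)
  have "(\<Sum>n<d. p / real d * outcome_prob (ketbra (b n)) (P 1 n)
             + (1 - p) / real d * outcome_prob (ketbra (c n)) (P 2 n))
      \<le> (\<Sum>n<d. ?M * Re (ctrace (P 1 n)) + ?M * Re (ctrace (P 2 n)))"
  \<comment> \<open>Each term is a prior times an expectation value: the prior is at most
    \<open>?M\<close>, the expectation value at most the trace. Nonnegativity of \<open>?M\<close>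
    and of the expectation value allows the two bounds to be multiplied.\<close>
  proof (rule sum_mono, rule add_mono)
    fix n assume "n \<in> {..<d}"
    then have n: "n < d" by simp
    have lin: "clinear (P 1 n)" "clinear (P 2 n)"
      and nn: "0 \<le> Re (cinner x (P 1 n x))" "0 \<le> Re (cinner x (P 2 n x))" for x
      using psd[OF n] by (auto simp: positive_semidefinite_def less_eq_complex_def)
    show "p / real d * outcome_prob (ketbra (b n)) (P 1 n) \<le> ?M * Re (ctrace (P 1 n))"
      unfolding outcome_prob_ketbra[OF b lin(1) n] using p nn
      by (intro mult_mono Re_cinner_le_ctrace[OF b psd(1)[OF n] n] divide_right_mono) auto
    show "(1 - p) / real d * outcome_prob (ketbra (c n)) (P 2 n) \<le> ?M * Re (ctrace (P 2 n))"
      unfolding outcome_prob_ketbra[OF c lin(2) n] using p nn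
      by (intro mult_mono Re_cinner_le_ctrace[OF c psd(2)[OF n] n] divide_right_mono) auto
  qed
  also have "\<dots> = ?M * Re (\<Sum>n<d. ctrace (P 1 n) + ctrace (P 2 n))"
    by (simp add: sum_distrib_left distrib_left)
  \<comment> \<open>The total trace d cancels the denominator of \<open>?M\<close>.\<close>
  also have "\<dots> = max p (1 - p)"
    unfolding sum_ctrace_povm[OF b P] using d by simp
  finally show ?thesis
    by (simp add: error_prob_def)
qed

text \<open>Completeness is the expansion of \<open>x\<close> in the basis \<open>c\<close>; the
  condition on \<open>j\<close> places the projectors among the outcomes that are summed.\<close>

lemma povm_basis_measurement:
  fixes c :: "nat \<Rightarrow> 'a::complex_inner"
  assumes c: "orthonormal_basis d c" and j: "j = 1 \<or> j = 2"
  shows "povm d (\<lambda>i n. if i = j then ketbra (c n) else (\<lambda>x. 0))"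
proof -
  have "(\<Sum>n<d. ketbra (c n) x) = x" for x
    using orthonormal_basis_expansion[OF c] by (simp add: ketbra_def)
  then show ?thesis
    using j by (auto simp: povm_def positive_semidefinite_ketbra positive_semidefinite_zero)
qed

lemma outcome_prob_ketbra_self:
  fixes c :: "nat \<Rightarrow> 'a::complex_inner"
  assumes c: "orthonormal_basis d c" and n: "n < d"
  shows "outcome_prob (ketbra (c n)) (ketbra (c n)) = 1"
  using outcome_prob_ketbra[OF c _ n, of "ketbra (c n)"] positive_semidefinite_ketbra[of "c n"] c n
  by (simp add: positive_semidefinite_def orthonormal_basis_def ketbra_def cinner_scaleC_right)

lemma outcome_prob_ketbra_zero:
  fixes c :: "nat \<Rightarrow> 'a::complex_inner"
  assumes c: "orthonormal_basis d c" and n: "n < d"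
  shows "outcome_prob (ketbra (c n)) (\<lambda>x. 0) = 0"
  using outcome_prob_ketbra[OF c _ n, of "\<lambda>x. 0"] positive_semidefinite_zero
  by (simp add: positive_semidefinite_def)

theorem mainTheorem5:
  fixes d :: nat and b :: "nat \<Rightarrow> 'a::complex_inner" and p :: real
  assumes "d \<ge> 1"
    and "cvec.dim (UNIV :: 'a set) = d"
    and "orthonormal_basis d b"
    and "0 \<le> p" and "p \<le> 1"
  shows "(p \<ge> 1/2 \<longrightarrow>
      attains_min_error d p (prepared_state d b)
        (\<lambda>i n. if i = 1 then ketbra (b n) else (\<lambda>x. 0))) \<and>
    (\<not> p \<ge> 1/2 \<longrightarrow>
      attains_min_error d p (prepared_state d b)
        (\<lambda>i n. if i = 2 then ketbra (fourier_vec d b n) else (\<lambda>x. 0)))"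
proof -
  let ?e = "fourier_vec d b"
  note b = \<open>orthonormal_basis d b\<close>
  note e = orthonormal_basis_fourier_vec[OF b]
  have rho: "prepared_state d b = (\<lambda>i n. if i = 1 then ketbra (b n) else ketbra (?e n))"
    by (auto simp: prepared_state_def fun_eq_iff)
  have lower: "1 - max p (1 - p) \<le> error_prob d p (prepared_state d b) Q" if "povm d Q" for Q
    unfolding rho using assms e that by (intro error_prob_lower_bound)
  \<comment> \<open>States of the measured basis are always identified and the others never, so the
    success probability is the total prior weight of that basis.\<close>
  have "error_prob d p (prepared_state d b) (\<lambda>i n. if i = 1 then ketbra (b n) else (\<lambda>x. 0))
      = 1 - p"
    using \<open>d \<ge> 1\<close>
    by (simp add: rho error_prob_def outcome_prob_ketbra_self[OF b] outcome_prob_ketbra_zero[OF e])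
  moreover have "error_prob d p (prepared_state d b)
      (\<lambda>i n. if i = 2 then ketbra (?e n) else (\<lambda>x. 0)) = p"
    using \<open>d \<ge> 1\<close>
    by (simp add: rho error_prob_def outcome_prob_ketbra_self[OF e] outcome_prob_ketbra_zero[OF b])
  \<comment> \<open>The maximum in \<open>lower\<close> is \<open>p\<close> exactly when
    \<open>p\<close> is at least 1/2 and \<open>1 - p\<close> otherwise, so in each case the
    computed error meets the bound.\<close>
  ultimately show ?thesis
    using lower povm_basis_measurement[OF b, of 1] povm_basis_measurement[OF e, of 2]
    by (force simp: attains_min_error_def)
qed

end
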